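(* For every integer $n\ge 4$ we have $f(n)\in\{f(n-1),\,f(n+1)\}$ and $L(n)\in\{L(n-1),\,L(n+1)\}$.
   Context: For an integer $n\ge 3$, $f(n)$ denotes the least positive integer $k$ such that $\binom{n}{k}>\frac{2^n}{n+1}$, and $L(n)$ denotes the least positive integer $k$ such that $\binom{n}{k}>\frac{2^n}{n}$. (Such $k$ exist for all $n\ge 3$.) *)

theory Defs
  imports Complex_Main
begin

text \<open>
  Both definitions are meant for \<open>n \<ge> 3\<close>, where a suitable \<open>k\<close> exists; for smaller
  \<open>n\<close> no \<open>k\<close> need exist, and the value of \<open>LEAST\<close> is then unspecified.
\<close>

definition f :: "nat \<Rightarrow> nat" where
  "f n = (LEAST k. 0 < k \<and> real (n choose k) > 2 ^ n / (real n + 1))"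

definition L :: "nat \<Rightarrow> nat" where
  "L n = (LEAST k. 0 < k \<and> real (n choose k) > 2 ^ n / real n)"

end

theory Submission imports Defs begin

text \<open>
  Both \<open>f\<close> and \<open>L\<close> are instances of one function: the position \<open>K n\<close> at which row \<open>n\<close> of Pascal's
  triangle first exceeds \<open>2 ^ n / (n + c)\<close>, where \<open>c\<close> is a constant with \<open>0 \<le> c \<le> n + 1\<close> (\<open>c = 1\<close>
  gives \<open>f\<close>, \<open>c = 0\<close> gives \<open>L\<close>). The theorem holds because \<open>K\<close> is nondecreasing while it grows by at
  most one over two rows: \<open>K (n - 1) \<le> K n \<le> K (n + 1) \<le> K (n - 1) + 1\<close>. In such a chain the
  integer \<open>K n\<close> must equal one of its neighbours.

  Both inequalities come from following the normalized entry \<open>(n choose k) * (n + c) / 2 ^ n\<close>, which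
  is to be compared with 1. When \<open>n\<close> grows and \<open>k < n / 2\<close> is fixed, the binomial coefficient grows by
  the factor \<open>(n + 1) / (n + 1 - k)\<close>, which falls short of 2 by enough that, even with the growth
  of \<open>n + c\<close>, the normalized entry does not increase (\<open>small_entry_stays_small\<close>). All positions
  before \<open>K n\<close> lie in the left half of the row, because the middle entry is already large enough
  (\<open>power2_less_times_middle_binomial\<close>); hence none of them becomes large in row \<open>n + 1\<close>.

  On the other hand, two rows down and one step to the right, the binomial coefficient grows by the
  factor \<open>(n + 1) * (n + 2) / ((k + 1) * (n + 1 - k))\<close>, and the inequality of the arithmetic and
  geometric means bounds \<open>(k + 1) * (n + 1 - k)\<close> by \<open>(n + 2)\<^sup>2 / 4\<close>. This suffices for the
  normalized entry not to decrease (\<open>large_entry_stays_large\<close>).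
\<close>

definition first_large :: "real \<Rightarrow> nat \<Rightarrow> nat" where
  "first_large c n = (LEAST k. 0 < k \<and> 2 ^ n / (real n + c) < real (n choose k))"

text \<open>
  The middle entry is at least the average of the row. Treating the two outermost entries
  separately, as a contribution of only 2, improves the average \<open>2 ^ n / (n + 1)\<close> to the
  strict bound by \<open>2 ^ n / n\<close>.
\<close>

lemma power2_less_times_middle_binomial:
  fixes n :: nat
  assumes "n \<ge> 3"
  shows "2 ^ n < n * (n choose (n div 2))"
proof -
  let ?M = "n choose (n div 2)"
  have split: "{..n} = insert 0 (insert n {1..<n})"
    using assms by auto
  have "2 ^ n = (\<Sum>k\<le>n. n choose k)"
    by (simp add: choose_row_sum)
  also have "\<dots> = 2 + (\<Sum>k=1..<n. n choose k)"
    unfolding split using assms by simp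
  also have "\<dots> \<le> 2 + (n - 1) * ?M"
    using sum_bounded_above[of "{1..<n}" "\<lambda>k. n choose k" ?M] by (simp add: binomial_maximum)
  also have "\<dots> < ?M + (n - 1) * ?M"
    using binomial_maximum[of n 1] assms by simp
  also have "\<dots> = n * ?M"
    using assms by (cases n) simp_all
  finally show ?thesis .
qed

lemma middle_entry_large:
  fixes c :: real
  assumes "n \<ge> 3" "c \<ge> 0"
  shows "0 < n div 2 \<and> 2 ^ n / (real n + c) < real (n choose (n div 2))"
proof -
  let ?M = "n choose (n div 2)"
  have "real (2 ^ n) < real (n * ?M)"
    using power2_less_times_middle_binomial[OF assms(1)] by (simp only: of_nat_less_iff)
  also have "\<dots> \<le> (real n + c) * real ?M"
    using assms(2) by (simp add: algebra_simps)
  finally show ?thesis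
    using assms by (simp add: divide_simps mult.commute)
qed

lemma first_large_le_half:
  assumes "n \<ge> 3" "c \<ge> 0"
  shows "first_large c n \<le> n div 2"
  unfolding first_large_def using middle_entry_large[OF assms] by (rule Least_le)

lemma first_large_is_large:
  assumes "n \<ge> 3" "c \<ge> 0"
  shows "0 < first_large c n \<and> 2 ^ n / (real n + c) < real (n choose first_large c n)"
  unfolding first_large_def using middle_entry_large[OF assms] by (rule LeastI)

text \<open>
  The binomial coefficient grows by the factor \<open>(n + 1) / (n + 1 - k)\<close>, so the point is that
  \<open>(n + 1) * (n + 1 + c) \<le> 2 * (n + 1 - k) * (n + c)\<close>; for \<open>2 * k \<le> n - 1\<close> the factor
  \<open>2 * (n + 1 - k)\<close> is at least \<open>n + 3\<close>, which is enough.
\<close>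

lemma small_entry_stays_small:
  fixes c :: real
  assumes "2 * k < n" "c \<ge> 0"
    and small: "real (n choose k) \<le> 2 ^ n / (real n + c)"
  shows "real (Suc n choose k) \<le> 2 ^ Suc n / (real (Suc n) + c)"
proof -
  define x y r where "x = real n" and "y = real k" and "r = real (Suc n choose k)"
  have xy: "2 * y + 1 \<le> x" "1 \<le> x" "0 \<le> y"
    using assms(1) unfolding x_def y_def by linarith+
  have "(Suc n - k) * (Suc n choose k) = Suc n * (n choose k)"
    using binomial_absorb_comp[of "Suc n" k] by simp
  then have "real (Suc n - k) * r = real (Suc n) * real (n choose k)"
    unfolding r_def by (simp only: flip: of_nat_mult)
  then have step: "(x + 1 - y) * r = (x + 1) * real (n choose k)"
    using assms(1) by (simp add: x_def y_def of_nat_diff algebra_simps)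
  have "(x + 1 - y) * r * (x + 1 + c) = (x + 1) * (x + 1 + c) * real (n choose k)"
    using step by (simp add: mult_ac)
  also have "\<dots> \<le> (x + 3) * (x + c) * real (n choose k)"
    using xy assms(2) by (intro mult_right_mono) (simp_all add: algebra_simps)
  also have "\<dots> \<le> (2 * (x + 1 - y)) * (x + c) * real (n choose k)"
    using xy assms(2) by (intro mult_right_mono) simp_all
  also have "\<dots> = 2 * (x + 1 - y) * ((x + c) * real (n choose k))"
    by (simp add: mult_ac)
  also have "\<dots> \<le> 2 * (x + 1 - y) * 2 ^ n"
    using small xy assms(2) by (intro mult_left_mono) (simp_all add: x_def field_simps)
  finally have "(x + 1 - y) * (r * (x + 1 + c)) \<le> (x + 1 - y) * 2 ^ Suc n"
    by (simp only: power_Suc mult_ac)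
  then have "r * (x + 1 + c) \<le> 2 ^ Suc n"
    using xy by (simp add: mult_le_cancel_left)
  then show ?thesis
    using xy assms(2) by (simp add: r_def x_def field_simps)
qed

text \<open>
  The ratio of the two binomial coefficients is \<open>(n + 1) * (n + 2) / ((k + 1) * (n + 1 - k))\<close>. As
  \<open>4 * (k + 1) * (n + 1 - k) \<le> (n + 2)\<^sup>2\<close>, it remains to see that
  \<open>(n + 2) * (n + c) \<le> (n + 1) * (n + 2 + c)\<close>, which is equivalent to \<open>c \<le> n + 2\<close>.
\<close>

lemma large_entry_stays_large:
  fixes c :: real
  assumes "k \<le> n" "0 < n" "c \<ge> 0" "c \<le> real n + 2"
    and large: "2 ^ n / (real n + c) < real (n choose k)"
  shows "2 ^ (n + 2) / (real (n + 2) + c) < real ((n + 2) choose Suc k)"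
proof -
  define x y r where "x = real n" and "y = real k" and "r = real ((n + 2) choose Suc k)"
  define P where "P = (y + 1) * (x + 1 - y)"
  have xy: "y \<le> x" "0 < x" "0 \<le> y" "c \<le> x + 2"
    using assms(1,2,4) unfolding x_def y_def by linarith+
  have P: "0 < P"
    using xy unfolding P_def by simp
  have "(x + 2)\<^sup>2 - 4 * P = (x - 2 * y)\<^sup>2"
    unfolding P_def by (simp add: power2_eq_square algebra_simps)
  then have amgm: "4 * P \<le> (x + 2)\<^sup>2"
    by (metis diff_ge_0_iff_ge zero_le_power2)
  have "Suc k * (Suc n - k) * ((n + 2) choose Suc k) = (Suc n - k) * (Suc (Suc n) * (Suc n choose k))"
    using Suc_times_binomial_eq[of "Suc n" k] by (simp only: add_2_eq_Suc' mult_ac)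
  also have "\<dots> = Suc (Suc n) * (Suc n * (n choose k))"
    using binomial_absorb_comp[of "Suc n" k] by (metis diff_Suc_1 mult.left_commute)
  finally have "real (Suc k) * real (Suc n - k) * r = real (Suc (Suc n)) * (real (Suc n) * real (n choose k))"
    unfolding r_def by (simp only: flip: of_nat_mult)
  then have step: "P * r = (x + 2) * (x + 1) * real (n choose k)"
    using assms(1) by (simp add: P_def x_def y_def of_nat_diff algebra_simps)
  have "P * 2 ^ (n + 2) = 4 * P * 2 ^ n"
    by simp
  also have "\<dots> < 4 * P * ((x + c) * real (n choose k))"
    using large P xy assms(3) by (intro mult_strict_left_mono) (simp_all add: x_def field_simps)
  also have "\<dots> \<le> (x + 2)\<^sup>2 * ((x + c) * real (n choose k))"
    using amgm xy assms(3) by (intro mult_right_mono) simp_all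
  also have "\<dots> = (x + 2) * ((x + 2) * (x + c)) * real (n choose k)"
    by (simp add: power2_eq_square mult_ac)
  also have "\<dots> \<le> (x + 2) * ((x + 1) * (x + 2 + c)) * real (n choose k)"
    using xy assms(3) by (intro mult_right_mono mult_left_mono) (simp_all add: algebra_simps)
  also have "\<dots> = P * (r * (x + 2 + c))"
    using step by (simp add: mult_ac)
  finally have "2 ^ (n + 2) < r * (x + 2 + c)"
    using P by (simp add: mult_less_cancel_left)
  then show ?thesis
    using xy assms(3) by (simp add: r_def x_def field_simps)
qed

lemma first_large_le_Suc:
  assumes "n \<ge> 3" "c \<ge> 0"
  shows "first_large c n \<le> first_large c (Suc n)"
proof (rule ccontr)
  let ?k = "first_large c (Suc n)"
  assume "\<not> first_large c n \<le> ?k"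
  then have less: "?k < first_large c n"
    by simp
  have large: "0 < ?k \<and> 2 ^ Suc n / (real (Suc n) + c) < real (Suc n choose ?k)"
    using assms by (intro first_large_is_large) simp_all
  have "\<not> (0 < ?k \<and> 2 ^ n / (real n + c) < real (n choose ?k))"
    using less unfolding first_large_def[of c n] by (rule not_less_Least)
  with large have "real (n choose ?k) \<le> 2 ^ n / (real n + c)"
    by simp
  moreover have "2 * ?k < n"
    using less first_large_le_half[OF assms] by linarith
  ultimately show False
    using small_entry_stays_small[of ?k n c] assms(2) large by simp
qed

lemma first_large_add_two_le:
  assumes "n \<ge> 3" "c \<ge> 0" "c \<le> real n + 2"
  shows "first_large c (n + 2) \<le> Suc (first_large c n)"
proof -
  let ?k = "first_large c n"
  have "?k \<le> n"
    using first_large_le_half[OF assms(1,2)] by linarith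
  then have "2 ^ (n + 2) / (real (n + 2) + c) < real ((n + 2) choose Suc ?k)"
    using assms first_large_is_large[OF assms(1,2)] by (intro large_entry_stays_large) simp_all
  then show ?thesis
    unfolding first_large_def[of c "n + 2"] by (intro Least_le) simp
qed

lemma first_large_eq_neighbour:
  assumes "n \<ge> 4" "c \<ge> 0" "c \<le> real n + 1"
  shows "first_large c n \<in> {first_large c (n - 1), first_large c (n + 1)}"
proof -
  obtain m where m: "n = Suc m" "m \<ge> 3"
    using assms(1) by (cases n) auto
  show ?thesis
    using first_large_le_Suc[OF m(2) assms(2)] first_large_le_Suc[of n c]
      first_large_add_two_le[OF m(2) assms(2)] m assms(2,3) by auto
qed

theorem theorem1p2:
  fixes n :: nat
  assumes "n \<ge> 4"
  shows "f n \<in> {f (n - 1), f (n + 1)} \<and> L n \<in> {L (n - 1), L (n + 1)}"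
proof -
  have "f = first_large 1" and "L = first_large 0"
    by (simp_all add: fun_eq_iff f_def L_def first_large_def)
  then show ?thesis
    using first_large_eq_neighbour[OF assms, of 1] first_large_eq_neighbour[OF assms, of 0]
    by simp
qed

end
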